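(* Let $t\in\mathbb C$ with $t\notin\{0,1,2,\dots\}$, and let $V_t$ be the super Verma module of $\mathfrak g_{\mathbb C}=\mathfrak{osp}_{\mathbb C}(1|2)$ of highest weight $t$. Then $V_t$ is unitary (with respect to the real form $\mathfrak g=\mathfrak{osp}_{\mathbb R}(1|2)$) if and only if $t$ is real and $t<0$.
   Context: $\mathfrak{osp}_{\mathbb C}(1|2)$ is the Lie superalgebra of $3\times3$ complex matrices (rows and columns indexed $1|2,3$) with even part $\cong\mathfrak{sl}(2)$ spanned by $H=E_{22}-E_{33}$, $X=E_{23}$, $Y=E_{32}$ and odd part spanned by $x=E_{13}+E_{21}$, $y=E_{12}-E_{31}$, where $E_{ij}$ are the elementary matrices; the bracket is the supercommutator (e.g. $xy+yx=H$, $x^2=X$, $y^2=-Y$). Its real form $\mathfrak{osp}_{\mathbb R}(1|2)$ has even part with real basis $\{iH,\ X+Y,\ i(X-Y)\}$ and odd part with real basis $\{-ix+y,\ -x+iy\}$. The super Verma module $V_t$ is the universal $\mathfrak g_{\mathbb C}$-module generated by a non-zero (homogeneous) vector $v_t$ with $Hv_t=tv_t$, $xv_t=0$ (hence $Xv_t=0$). Unitary: a $\mathfrak g_{\mathbb C}$-module $V=V_0\oplus V_1$ (action denoted $\gamma$) is unitary if it admits a positive definite hermitian product $\langle\cdot,\cdot\rangle$ with $V_0\perp V_1$ such that $i\gamma(Z)$ is symmetric on $V$ for all $Z\in\mathfrak g_0$ and $e^{-i\pi/4}\gamma(Z)$ is symmetric on $V$ for all $Z\in\mathfrak g_1$, where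 $\mathfrak g=\mathfrak g_0\oplus\mathfrak g_1$ is the real form above (symmetric: $\langle Au,v\rangle=\langle u,Av\rangle$ for all $u,v\in V$). *)

theory Defs
  imports
    "HOL-Analysis.Analysis"
    "HOL-Library.Z2"
    "HOL-Computational_Algebra.Polynomial"
begin

section \<open>The Lie superalgebra $\mathfrak{osp}(1|2)$\<close>

definition elem_mat :: "3 \<Rightarrow> 3 \<Rightarrow> complex^3^3" where
  "elem_mat i j = (\<chi> k l. if k = i \<and> l = j then 1 else 0)"

definition cmat_scale :: "complex \<Rightarrow> complex^3^3 \<Rightarrow> complex^3^3" where
  "cmat_scale c A = (\<chi> i j. c * A $ i $ j)"

interpretation gl: vector_space cmat_scale
  by unfold_locales (simp_all add: cmat_scale_def vec_eq_iff algebra_simps)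

definition osp_H :: "complex^3^3" where "osp_H = elem_mat 2 2 - elem_mat 3 3"
definition osp_X :: "complex^3^3" where "osp_X = elem_mat 2 3"
definition osp_Y :: "complex^3^3" where "osp_Y = elem_mat 3 2"
definition osp_x :: "complex^3^3" where "osp_x = elem_mat 1 3 + elem_mat 2 1"
definition osp_y :: "complex^3^3" where "osp_y = elem_mat 1 2 - elem_mat 3 1"

text \<open>Parities are elements of the two-element field \<^typ>\<open>bit\<close>, so that the parity of a product
  is a sum in \<^typ>\<open>bit\<close>, and \<^prop>\<open>p * q = (1::bit)\<close> says that both parities are odd.\<close>

definition osp :: "(complex^3^3) set" where
  "osp = gl.span {osp_H, osp_X, osp_Y, osp_x, osp_y}"

definition osp_part :: "bit \<Rightarrow> (complex^3^3) set" where
  "osp_part p = (if p = 0 then gl.span {osp_H, osp_X, osp_Y} else gl.span {osp_x, osp_y})"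

definition superbracket :: "bit \<Rightarrow> bit \<Rightarrow> complex^3^3 \<Rightarrow> complex^3^3 \<Rightarrow> complex^3^3" where
  "superbracket p q A B = (if p * q = 1 then A ** B + B ** A else A ** B - B ** A)"

text \<open>The real form; here \<^const>\<open>span\<close> is the real span.\<close>

definition osp_real_part :: "bit \<Rightarrow> (complex^3^3) set" where
  "osp_real_part p =
     (if p = 0
      then span {cmat_scale \<i> osp_H, osp_X + osp_Y, cmat_scale \<i> (osp_X - osp_Y)}
      else span {cmat_scale (- \<i>) osp_x + osp_y, - osp_x + cmat_scale \<i> osp_y})"


section \<open>Modules\<close>

text \<open>A module is the whole type \<^typ>\<open>'v\<close>, with complex scalar multiplication \<open>smul\<close>, grading
  \<open>V 0 \<oplus> V 1\<close> and action \<open>\<gamma>\<close>. The values of \<open>\<gamma>\<close> on matrices outside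
  \<^const>\<open>osp\<close> are irrelevant.\<close>

locale osp_module = vector_space smul
  for smul :: "complex \<Rightarrow> 'v::ab_group_add \<Rightarrow> 'v" +
  fixes V :: "bit \<Rightarrow> 'v set"
    and \<gamma> :: "complex^3^3 \<Rightarrow> 'v \<Rightarrow> 'v"
  assumes subspace_part: "subspace (V p)"
    and parts_disjoint: "V 0 \<inter> V 1 = {0}"
    and parts_sum: "\<exists>a\<in>V 0. \<exists>b\<in>V 1. u = a + b"
    and action_linear: "Z \<in> osp \<Longrightarrow> Vector_Spaces.linear smul smul (\<gamma> Z)"
    and action_add: "A \<in> osp \<Longrightarrow> B \<in> osp \<Longrightarrow> \<gamma> (A + B) u = \<gamma> A u + \<gamma> B u"
    and action_scale: "A \<in> osp \<Longrightarrow> \<gamma> (cmat_scale c A) u = smul c (\<gamma> A u)"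
    and action_graded: "Z \<in> osp_part p \<Longrightarrow> u \<in> V q \<Longrightarrow> \<gamma> Z u \<in> V (p + q)"
    and action_bracket: "A \<in> osp_part p \<Longrightarrow> B \<in> osp_part q \<Longrightarrow>
      \<gamma> (superbracket p q A B) u =
        (if p * q = 1 then \<gamma> A (\<gamma> B u) + \<gamma> B (\<gamma> A u) else \<gamma> A (\<gamma> B u) - \<gamma> B (\<gamma> A u))"

definition osp_hom ::
  "(complex \<Rightarrow> 'v::ab_group_add \<Rightarrow> 'v) \<Rightarrow> (bit \<Rightarrow> 'v set) \<Rightarrow> (complex^3^3 \<Rightarrow> 'v \<Rightarrow> 'v) \<Rightarrow>
   (complex \<Rightarrow> 'w::ab_group_add \<Rightarrow> 'w) \<Rightarrow> (bit \<Rightarrow> 'w set) \<Rightarrow> (complex^3^3 \<Rightarrow> 'w \<Rightarrow> 'w) \<Rightarrow>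
   ('v \<Rightarrow> 'w) \<Rightarrow> bool" where
  "osp_hom smul V \<gamma> smul' W \<delta> f \<longleftrightarrow>
     Vector_Spaces.linear smul smul' f \<and>
     (\<forall>q. f ` V q \<subseteq> W q) \<and>
     (\<forall>Z\<in>osp. \<forall>u. f (\<gamma> Z u) = \<delta> Z (f u))"

text \<open>\<open>generated_by\<close>: the only submodule containing \<open>v\<close> is the whole module.\<close>

definition generated_by ::
  "(complex \<Rightarrow> 'v::ab_group_add \<Rightarrow> 'v) \<Rightarrow> (complex^3^3 \<Rightarrow> 'v \<Rightarrow> 'v) \<Rightarrow> 'v \<Rightarrow> bool" where
  "generated_by smul \<gamma> v \<longleftrightarrow>
     (\<forall>S. module.subspace smul S \<and> (\<forall>Z\<in>osp. \<forall>u\<in>S. \<gamma> Z u \<in> S) \<and> v \<in> S \<longrightarrow> S = UNIV)"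

text \<open>\<open>highest_weight_vector\<close>: \<open>w\<close> is homogeneous of parity \<open>r\<close> and satisfies the two relations
  imposed on the generator of the super Verma module; \<open>w = 0\<close> is allowed.\<close>

definition highest_weight_vector ::
  "(complex \<Rightarrow> 'w::ab_group_add \<Rightarrow> 'w) \<Rightarrow> (bit \<Rightarrow> 'w set) \<Rightarrow> (complex^3^3 \<Rightarrow> 'w \<Rightarrow> 'w) \<Rightarrow>
   complex \<Rightarrow> bit \<Rightarrow> 'w \<Rightarrow> bool" where
  "highest_weight_vector smul W \<delta> t r w \<longleftrightarrow>
     w \<in> W r \<and> \<delta> osp_H w = smul t w \<and> \<delta> osp_x w = 0"

text \<open>The super Verma module, by its universal property. A definition cannot quantify over the
  types carrying the test modules \<open>W\<close>, so they are taken on the space \<^typ>\<open>complex poly\<close> of countably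
  infinite dimension. This is no restriction: a submodule generated by one vector has
  countable dimension, and adding a trivial module of countably infinite dimension gives a module
  isomorphic to one on \<^typ>\<open>complex poly\<close>. The universal property with respect to modules on
  arbitrary types, as well as the existence of super Verma modules, is proved at the end of this
  theory.\<close>

definition super_verma ::
  "complex \<Rightarrow> (complex \<Rightarrow> 'v::ab_group_add \<Rightarrow> 'v) \<Rightarrow> (bit \<Rightarrow> 'v set) \<Rightarrow>
   (complex^3^3 \<Rightarrow> 'v \<Rightarrow> 'v) \<Rightarrow> 'v \<Rightarrow> bool" where
  "super_verma t smul V \<gamma> v \<longleftrightarrow>
     osp_module smul V \<gamma> \<and> v \<noteq> 0 \<and> generated_by smul \<gamma> v \<and>
     (\<exists>r. highest_weight_vector smul V \<gamma> t r v \<and>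
        (\<forall>(W :: bit \<Rightarrow> complex poly set) \<delta> w.
           osp_module smult W \<delta> \<and> highest_weight_vector smult W \<delta> t r w \<longrightarrow>
           (\<exists>f. osp_hom smul V \<gamma> smult W \<delta> f \<and> f v = w)))"


section \<open>Unitarity\<close>

definition positive_hermitian ::
  "(complex \<Rightarrow> 'v::ab_group_add \<Rightarrow> 'v) \<Rightarrow> ('v \<Rightarrow> 'v \<Rightarrow> complex) \<Rightarrow> bool" where
  "positive_hermitian smul h \<longleftrightarrow>
     (\<forall>u v w. h (u + v) w = h u w + h v w) \<and>
     (\<forall>c u v. h (smul c u) v = c * h u v) \<and>
     (\<forall>u v. h v u = cnj (h u v)) \<and>
     (\<forall>u. u \<noteq> 0 \<longrightarrow> h u u \<in> \<real> \<and> Re (h u u) > 0)"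

definition symmetric_wrt :: "('v \<Rightarrow> 'v \<Rightarrow> complex) \<Rightarrow> ('v \<Rightarrow> 'v) \<Rightarrow> bool" where
  "symmetric_wrt h A \<longleftrightarrow> (\<forall>u v. h (A u) v = h u (A v))"

definition unitary ::
  "(complex \<Rightarrow> 'v::ab_group_add \<Rightarrow> 'v) \<Rightarrow> (bit \<Rightarrow> 'v set) \<Rightarrow> (complex^3^3 \<Rightarrow> 'v \<Rightarrow> 'v) \<Rightarrow> bool" where
  "unitary smul V \<gamma> \<longleftrightarrow>
     (\<exists>h. positive_hermitian smul h \<and>
        (\<forall>u\<in>V 0. \<forall>v\<in>V 1. h u v = 0) \<and>
        (\<forall>Z\<in>osp_real_part 0. symmetric_wrt h (\<lambda>u. smul \<i> (\<gamma> Z u))) \<and>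
        (\<forall>Z\<in>osp_real_part 1. symmetric_wrt h (\<lambda>u. smul (exp (- \<i> * of_real pi / 4)) (\<gamma> Z u))))"


section \<open>Existence and universality of super Verma modules\<close>

lemmas osp_gen_defs = osp_H_def osp_X_def osp_Y_def osp_x_def osp_y_def

lemma mem_osp_iff:
  "Z \<in> osp \<longleftrightarrow> (\<exists>a b c d e. Z = cmat_scale a osp_H + cmat_scale b osp_X + cmat_scale c osp_Y
     + cmat_scale d osp_x + cmat_scale e osp_y)"
  unfolding osp_def gl.span_insert gl.span_empty by (auto simp: algebra_simps)

lemma mem_osp_part_0_iff:
  "Z \<in> osp_part 0 \<longleftrightarrow>
     (\<exists>a b c. Z = cmat_scale a osp_H + cmat_scale b osp_X + cmat_scale c osp_Y)"
  unfolding osp_part_def gl.span_insert gl.span_empty by (auto simp: algebra_simps)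

lemma mem_osp_part_1_iff:
  "Z \<in> osp_part 1 \<longleftrightarrow> (\<exists>d e. Z = cmat_scale d osp_x + cmat_scale e osp_y)"
  unfolding osp_part_def gl.span_insert gl.span_empty by (auto simp: algebra_simps)

lemma osp_gens [simp]: "osp_H \<in> osp" "osp_X \<in> osp" "osp_Y \<in> osp" "osp_x \<in> osp" "osp_y \<in> osp"
  by (simp_all add: osp_def gl.span_base)

lemma osp_part_gens [simp]:
  "osp_H \<in> osp_part 0" "osp_X \<in> osp_part 0" "osp_Y \<in> osp_part 0"
  "osp_x \<in> osp_part 1" "osp_y \<in> osp_part 1"
  by (simp_all add: osp_part_def gl.span_base)

lemma osp_add: "A \<in> osp \<Longrightarrow> B \<in> osp \<Longrightarrow> A + B \<in> osp"
  by (simp add: osp_def gl.span_add)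

lemma osp_scale: "A \<in> osp \<Longrightarrow> cmat_scale c A \<in> osp"
  by (simp add: osp_def gl.span_scale)

lemma osp_part_subset: "osp_part p \<subseteq> osp"
  unfolding osp_part_def osp_def by (auto intro: gl.span_mono[THEN subsetD, rotated])

lemma entry3 [simp]:
  "(1::3) \<noteq> 2" "(1::3) \<noteq> 3" "(2::3) \<noteq> 3" "(2::3) \<noteq> 1" "(3::3) \<noteq> 1" "(3::3) \<noteq> 2"
  by simp_all

lemma bracket_gens:
  "superbracket 1 1 osp_x osp_y = osp_H"
  "superbracket 1 1 osp_x osp_x = cmat_scale 2 osp_X"
  "superbracket 1 1 osp_y osp_y = - cmat_scale 2 osp_Y"
  "superbracket 1 1 osp_y osp_x = osp_H"
  "superbracket 0 0 osp_H osp_H = 0"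
  "superbracket 0 0 osp_H osp_X = cmat_scale 2 osp_X"
  "superbracket 0 0 osp_H osp_Y = - cmat_scale 2 osp_Y"
  "superbracket 0 0 osp_X osp_H = - cmat_scale 2 osp_X"
  "superbracket 0 0 osp_X osp_X = 0"
  "superbracket 0 0 osp_X osp_Y = osp_H"
  "superbracket 0 0 osp_Y osp_H = cmat_scale 2 osp_Y"
  "superbracket 0 0 osp_Y osp_X = - osp_H"
  "superbracket 0 0 osp_Y osp_Y = 0"
  "superbracket 0 1 osp_H osp_x = osp_x"
  "superbracket 1 0 osp_x osp_H = - osp_x"
  "superbracket 0 1 osp_H osp_y = - osp_y"
  "superbracket 1 0 osp_y osp_H = osp_y"
  "superbracket 0 1 osp_X osp_x = 0"
  "superbracket 1 0 osp_x osp_X = 0"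
  "superbracket 0 1 osp_X osp_y = - osp_x"
  "superbracket 1 0 osp_y osp_X = osp_x"
  "superbracket 0 1 osp_Y osp_x = - osp_y"
  "superbracket 1 0 osp_x osp_Y = osp_y"
  "superbracket 0 1 osp_Y osp_y = 0"
  "superbracket 1 0 osp_y osp_Y = 0"
  by (simp_all add: superbracket_def osp_gen_defs elem_mat_def cmat_scale_def vec_eq_iff
      matrix_matrix_mult_def sum_3 forall_3)

context osp_module
begin

lemma act_add: "Z \<in> osp \<Longrightarrow> \<gamma> Z (u + v) = \<gamma> Z u + \<gamma> Z v"
  and act_scale: "Z \<in> osp \<Longrightarrow> \<gamma> Z (smul c u) = smul c (\<gamma> Z u)"
  using action_linear[of Z] unfolding Vector_Spaces.linear_def module_hom_def module_hom_axioms_def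
  by simp_all

lemma act_zero: "Z \<in> osp \<Longrightarrow> \<gamma> Z 0 = 0"
  using act_add[of Z 0 0] by simp

lemma rel_xy: "\<gamma> osp_x (\<gamma> osp_y u) = \<gamma> osp_H u - \<gamma> osp_y (\<gamma> osp_x u)"
  using action_bracket[of osp_x 1 osp_y 1 u] by (simp add: bracket_gens)

lemma rel_X: "\<gamma> osp_X u = \<gamma> osp_x (\<gamma> osp_x u)"
proof -
  have "smul 2 (\<gamma> osp_X u) = smul 2 (\<gamma> osp_x (\<gamma> osp_x u))"
    using action_bracket[of osp_x 1 osp_x 1 u]
    by (simp add: bracket_gens action_scale scale_left_distrib[of 1 1, simplified])
  then show ?thesis by simp
qed

lemma action_minus: "A \<in> osp \<Longrightarrow> \<gamma> (- A) u = - \<gamma> A u"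
  using action_scale[of A "-1" u] by simp

lemma rel_Y: "\<gamma> osp_Y u = - \<gamma> osp_y (\<gamma> osp_y u)"
proof -
  have "- smul 2 (\<gamma> osp_Y u) = smul 2 (\<gamma> osp_y (\<gamma> osp_y u))"
    using action_bracket[of osp_y 1 osp_y 1 u]
    by (simp only: bracket_gens action_minus action_scale osp_gens osp_scale osp_part_gens mult_1
        if_True simp_thms scale_left_distrib[of 1 1, simplified])
  then have "smul 2 (\<gamma> osp_Y u) = smul 2 (- \<gamma> osp_y (\<gamma> osp_y u))"
    by (simp only: scale_minus_right minus_equation_iff) (metis minus_minus)
  then show ?thesis by (metis scale_cancel_left zero_neq_numeral)
qed

lemma rel_Hy: "\<gamma> osp_H (\<gamma> osp_y u) = \<gamma> osp_y (\<gamma> osp_H u) - \<gamma> osp_y u"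
  using action_bracket[of osp_H 0 osp_y 1 u] by (simp add: bracket_gens action_minus algebra_simps)

lemma action_expand:
  "\<gamma> (cmat_scale a osp_H + cmat_scale b osp_X + cmat_scale c osp_Y
      + cmat_scale d osp_x + cmat_scale e osp_y) u =
   smul a (\<gamma> osp_H u) + smul b (\<gamma> osp_X u) + smul c (\<gamma> osp_Y u)
   + smul d (\<gamma> osp_x u) + smul e (\<gamma> osp_y u)"
  by (simp add: action_add action_scale osp_add osp_scale)

end

text \<open>The model of the super Verma module: the polynomial \<open>monom 1 k\<close> stands for the
  vector $y^k v_t$, and $x y^k v_t = c_k y^{k-1} v_t$ with \<open>c\<^sub>k = vm_coef t k\<close>.\<close>

definition vm_coef :: "complex \<Rightarrow> nat \<Rightarrow> complex" where
  "vm_coef t k = (if even k then - of_nat k / 2 else t - (of_nat k - 1) / 2)"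

definition vm_H :: "complex \<Rightarrow> complex poly \<Rightarrow> complex poly" where
  "vm_H t p = Abs_poly (\<lambda>n. (t - of_nat n) * coeff p n)"

definition vm_x :: "complex \<Rightarrow> complex poly \<Rightarrow> complex poly" where
  "vm_x t p = Abs_poly (\<lambda>n. vm_coef t (Suc n) * coeff p (Suc n))"

definition vm_y :: "complex poly \<Rightarrow> complex poly" where
  "vm_y p = pCons 0 p"

definition vm_act :: "complex \<Rightarrow> complex^3^3 \<Rightarrow> complex poly \<Rightarrow> complex poly" where
  "vm_act t Z p = smult (Z $ 2 $ 2) (vm_H t p) + smult (Z $ 2 $ 3) (vm_x t (vm_x t p))
     - smult (Z $ 3 $ 2) (vm_y (vm_y p)) + smult (Z $ 1 $ 3) (vm_x t p) + smult (Z $ 1 $ 2) (vm_y p)"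

definition vm_part :: "bit \<Rightarrow> bit \<Rightarrow> complex poly set" where
  "vm_part r q = {p. \<forall>k. coeff p k \<noteq> 0 \<longrightarrow> of_nat k + r = q}"

lemma coeff_vm_H [simp]: "coeff (vm_H t p) n = (t - of_nat n) * coeff p n"
  unfolding vm_H_def by (subst coeff_Abs_poly[where n = "degree p"]) (auto simp: coeff_eq_0)

lemma coeff_vm_x [simp]: "coeff (vm_x t p) n = vm_coef t (Suc n) * coeff p (Suc n)"
  unfolding vm_x_def by (subst coeff_Abs_poly[where n = "degree p"]) (auto simp: coeff_eq_0)

lemma vm_coef_Suc: "vm_coef t (Suc n) = t - of_nat n - vm_coef t n"
  by (auto simp: vm_coef_def field_simps)

lemma vm_add:
  "vm_H t (p + q) = vm_H t p + vm_H t q" "vm_x t (p + q) = vm_x t p + vm_x t q"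
  "vm_y (p + q) = vm_y p + vm_y q"
  "vm_H t (p - q) = vm_H t p - vm_H t q" "vm_x t (p - q) = vm_x t p - vm_x t q"
  "vm_y (p - q) = vm_y p - vm_y q"
  by (simp_all add: poly_eq_iff algebra_simps vm_y_def)

lemma vm_smult:
  "vm_H t (smult c p) = smult c (vm_H t p)" "vm_x t (smult c p) = smult c (vm_x t p)"
  "vm_y (smult c p) = smult c (vm_y p)"
  by (simp_all add: poly_eq_iff algebra_simps vm_y_def)

lemma vm_rel:
  "vm_x t (vm_y p) = vm_H t p - vm_y (vm_x t p)"
  "vm_H t (vm_y p) = vm_y (vm_H t p) - vm_y p"
  "vm_x t (vm_H t p) = vm_H t (vm_x t p) - vm_x t p"
proof -
  show "vm_x t (vm_y p) = vm_H t p - vm_y (vm_x t p)"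
    by (rule poly_eqI, rename_tac n, case_tac n)
       (auto simp: vm_y_def vm_coef_Suc algebra_simps, simp add: vm_coef_def)
  show "vm_H t (vm_y p) = vm_y (vm_H t p) - vm_y p"
    by (rule poly_eqI, rename_tac n, case_tac n) (auto simp: vm_y_def algebra_simps)
  show "vm_x t (vm_H t p) = vm_H t (vm_x t p) - vm_x t p"
    by (rule poly_eqI) (auto simp: algebra_simps)
qed

lemma vm_act_expand:
  "vm_act t (cmat_scale a osp_H + cmat_scale b osp_X + cmat_scale c osp_Y
      + cmat_scale d osp_x + cmat_scale e osp_y) p =
   smult a (vm_H t p) + smult b (vm_x t (vm_x t p)) - smult c (vm_y (vm_y p))
   + smult d (vm_x t p) + smult e (vm_y p)"
  by (simp add: vm_act_def osp_gen_defs elem_mat_def cmat_scale_def)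

lemma vm_act_gens:
  "vm_act t osp_H p = vm_H t p" "vm_act t osp_X p = vm_x t (vm_x t p)"
  "vm_act t osp_Y p = - vm_y (vm_y p)" "vm_act t osp_x p = vm_x t p" "vm_act t osp_y p = vm_y p"
  by (simp_all add: vm_act_def osp_gen_defs elem_mat_def)

lemma vm_act_add: "vm_act t (A + B) p = vm_act t A p + vm_act t B p"
  and vm_act_diff: "vm_act t (A - B) p = vm_act t A p - vm_act t B p"
  and vm_act_scale: "vm_act t (cmat_scale c A) p = smult c (vm_act t A p)"
  by (simp_all add: vm_act_def cmat_scale_def smult_add_left smult_add_right smult_diff_left
      smult_diff_right algebra_simps)

lemma bit_cases: "(p::bit) = 0 \<or> p = 1"
  by (cases p) auto

lemma vm_part_cases:
  "u \<in> vm_part r q \<Longrightarrow> vm_H t u \<in> vm_part r q"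
  "u \<in> vm_part r q \<Longrightarrow> vm_x t u \<in> vm_part r (q + 1)"
  "u \<in> vm_part r q \<Longrightarrow> vm_y u \<in> vm_part r (q + 1)"
proof -
  assume *: "u \<in> vm_part r q"
  show "vm_H t u \<in> vm_part r q" using * by (auto simp: vm_part_def)
  show "vm_x t u \<in> vm_part r (q + 1)"
  proof -
    have "of_nat k + r = q + 1" if "coeff (vm_x t u) k \<noteq> 0" for k
    proof -
      have "of_nat (Suc k) + r = q" using * that by (auto simp: vm_part_def simp del: of_nat_Suc)
      then show ?thesis using bit_cases[of "of_nat k"] bit_cases[of r] bit_cases[of q] by auto
    qed
    then show ?thesis by (auto simp: vm_part_def)
  qed
  show "vm_y u \<in> vm_part r (q + 1)"
  proof -
    have "of_nat k + r = q + 1" if k: "coeff (vm_y u) k \<noteq> 0" for k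
    proof (cases k)
      case 0
      then show ?thesis using k by (simp add: vm_y_def)
    next
      case (Suc m)
      then have "of_nat m + r = q" using * k by (auto simp: vm_part_def vm_y_def)
      then show ?thesis using Suc bit_cases[of "of_nat m"] bit_cases[of r] bit_cases[of q] by auto
    qed
    then show ?thesis by (auto simp: vm_part_def)
  qed
qed

lemma vm_part_lin:
  "0 \<in> vm_part r q"
  "u \<in> vm_part r q \<Longrightarrow> v \<in> vm_part r q \<Longrightarrow> u + v \<in> vm_part r q"
  "u \<in> vm_part r q \<Longrightarrow> v \<in> vm_part r q \<Longrightarrow> u - v \<in> vm_part r q"
  "u \<in> vm_part r q \<Longrightarrow> smult c u \<in> vm_part r q"
proof -
  have *: "u \<in> vm_part r q \<longleftrightarrow> (\<forall>k. of_nat k + r \<noteq> q \<longrightarrow> coeff u k = 0)" for u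
    unfolding vm_part_def by blast
  show "0 \<in> vm_part r q" by (simp add: *)
  show "u + v \<in> vm_part r q" "u - v \<in> vm_part r q" if "u \<in> vm_part r q" "v \<in> vm_part r q"
    using that unfolding * by simp_all
  show "smult c u \<in> vm_part r q" if "u \<in> vm_part r q"
    using that unfolding * by simp
qed

interpretation poly_vs: vector_space "smult :: complex \<Rightarrow> complex poly \<Rightarrow> complex poly"
  by unfold_locales (simp_all add: smult_add_left smult_add_right)

lemma vm_decompose: "\<exists>a\<in>vm_part r 0. \<exists>b\<in>vm_part r 1. u = a + b"
proof -
  define a where "a = Abs_poly (\<lambda>k. if of_nat k + r = 0 then coeff u k else 0)"
  have a: "coeff a k = (if of_nat k + r = 0 then coeff u k else 0)" for k
    unfolding a_def by (subst coeff_Abs_poly[where n = "degree u"]) (auto simp: coeff_eq_0)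
  have "a \<in> vm_part r 0" by (auto simp: vm_part_def a)
  moreover have "u - a \<in> vm_part r 1"
    unfolding vm_part_def using bit_cases by (auto simp: a split: if_splits)
  ultimately show ?thesis by (metis add_diff_cancel_left' diff_add_cancel add.commute)
qed

lemma superbracket_bilinear:
  "superbracket p q (A + A') B = superbracket p q A B + superbracket p q A' B"
  "superbracket p q A (B + B') = superbracket p q A B + superbracket p q A B'"
  "superbracket p q (cmat_scale c A) B = cmat_scale c (superbracket p q A B)"
  "superbracket p q A (cmat_scale c B) = cmat_scale c (superbracket p q A B)"
  by (auto simp: superbracket_def cmat_scale_def vec_eq_iff matrix_matrix_mult_def
      sum_distrib_left sum.distrib algebra_simps)

lemma superbracket_zero: "superbracket p q 0 B = 0" "superbracket p q A 0 = 0"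
  by (auto simp: superbracket_def vec_eq_iff matrix_matrix_mult_def)

lemma vm_minus:
  "vm_H t (- p) = - vm_H t p" "vm_x t (- p) = - vm_x t p" "vm_y (- p) = - vm_y p"
  by (simp_all add: poly_eq_iff vm_y_def)

lemma vm_superbracket_gens:
  assumes "A \<in> (if p = 0 then {osp_H, osp_X, osp_Y} else {osp_x, osp_y})"
    and "B \<in> (if q = 0 then {osp_H, osp_X, osp_Y} else {osp_x, osp_y})"
  shows "vm_act t (superbracket p q A B) u =
    (if p * q = 1 then vm_act t A (vm_act t B u) + vm_act t B (vm_act t A u)
     else vm_act t A (vm_act t B u) - vm_act t B (vm_act t A u))"
proof -
  have two: "smult 2 v = v + v" for v :: "complex poly"
    using smult_add_left[of 1 1 v] by simp
  have neg: "vm_act t (- A) v = - vm_act t A v" and zero: "vm_act t 0 v = 0" for A v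
    by (simp_all add: vm_act_def)
  note rules = bracket_gens vm_act_gens vm_act_scale neg zero vm_add vm_minus vm_rel two
  consider "p = 0" "q = 0" | "p = 0" "q = 1" | "p = 1" "q = 0" | "p = 1" "q = 1"
    using bit_cases by blast
  then show ?thesis
  proof cases
    case 1
    then have "A \<in> {osp_H, osp_X, osp_Y}" "B \<in> {osp_H, osp_X, osp_Y}" using assms by simp_all
    with 1 show ?thesis by (elim insertE emptyE) (simp_all add: rules)
  next
    case 2
    then have "A \<in> {osp_H, osp_X, osp_Y}" "B \<in> {osp_x, osp_y}" using assms by simp_all
    with 2 show ?thesis by (elim insertE emptyE) (simp_all add: rules)
  next
    case 3
    then have "A \<in> {osp_x, osp_y}" "B \<in> {osp_H, osp_X, osp_Y}" using assms by simp_all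
    with 3 show ?thesis by (elim insertE emptyE) (simp_all add: rules)
  next
    case 4
    then have "A \<in> {osp_x, osp_y}" "B \<in> {osp_x, osp_y}" using assms by simp_all
    with 4 show ?thesis by (elim insertE emptyE) (simp_all add: rules)
  qed
qed

lemma vm_superbracket:
  assumes "A \<in> osp_part p" "B \<in> osp_part q"
  shows "vm_act t (superbracket p q A B) u =
    (if p * q = 1 then vm_act t A (vm_act t B u) + vm_act t B (vm_act t A u)
     else vm_act t A (vm_act t B u) - vm_act t B (vm_act t A u))"
proof -
  define e where "e \<longleftrightarrow> p * q = 1"
  let ?G = "\<lambda>p::bit. if p = 0 then {osp_H, osp_X, osp_Y} else {osp_x, osp_y}"
  let ?P = "\<lambda>A B. vm_act t (superbracket p q A B) u =
    (if e then vm_act t A (vm_act t B u) + vm_act t B (vm_act t A u)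
     else vm_act t A (vm_act t B u) - vm_act t B (vm_act t A u))"
  have span: "osp_part p = gl.span (?G p)" for p by (simp add: osp_part_def)
  have zero: "vm_act t 0 v = 0" "vm_act t Z 0 = 0" for v Z
    by (simp_all add: vm_act_def poly_eq_iff vm_y_def)
  have lin: "vm_act t Z (v + w) = vm_act t Z v + vm_act t Z w"
    "vm_act t Z (smult c v) = smult c (vm_act t Z v)" for Z v w c
    by (simp_all add: vm_act_def vm_add vm_smult algebra_simps smult_add_right smult_diff_right)
  have sub1: "gl.subspace {A. ?P A B}" for B
    unfolding gl.subspace_def
    by (cases e)
       (simp_all add: superbracket_bilinear superbracket_zero vm_act_add vm_act_scale
          zero lin smult_add_right smult_diff_right)
  have sub2: "gl.subspace {B. ?P A B}" for A
    unfolding gl.subspace_def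
    by (cases e)
       (simp_all add: superbracket_bilinear superbracket_zero vm_act_add vm_act_scale
          zero lin smult_add_right smult_diff_right)
  have "?P A B" if "A \<in> ?G p" for A
    using assms(2) unfolding span
    by (rule gl.span_induct[OF _ sub2]) (rule vm_superbracket_gens[where p = p and q = q, OF that, folded e_def])
  with assms(1) show ?thesis unfolding span e_def[symmetric]
    using gl.span_induct[OF _ sub1] by blast
qed

lemma vm_module: "osp_module smult (vm_part r) (vm_act t)"
proof (unfold_locales, goal_cases)
  case (1 p)
  then show ?case by (simp add: poly_vs.subspace_def vm_part_lin)
next
  case 2
  show ?case by (auto simp: vm_part_def poly_eq_iff)
next
  case (3 u)
  show ?case by (rule vm_decompose)
next
  case (4 Z)
  show ?case
    by (simp add: vm_act_def vm_add vm_smult algebra_simps smult_add_right smult_diff_right)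
next
  case (5 Z)
  show ?case
    by (simp add: vm_act_def vm_add vm_smult algebra_simps smult_add_right smult_diff_right)
next
  case (6 A B u)
  show ?case by (rule vm_act_add)
next
  case (7 A c u)
  show ?case by (rule vm_act_scale)
next
  case (8 Z p u q)
  show ?case
  proof (cases "p = 0")
    case True
    then obtain a b c where Z: "Z = cmat_scale a osp_H + cmat_scale b osp_X + cmat_scale c osp_Y"
      using 8 mem_osp_part_0_iff by auto
    have "q + 1 + 1 = q" using bit_cases[of q] by auto
    then have "vm_x t (vm_x t u) \<in> vm_part r q" "vm_y (vm_y u) \<in> vm_part r q"
      using vm_part_cases(2)[OF vm_part_cases(2), OF 8(2)]
        vm_part_cases(3)[OF vm_part_cases(3), OF 8(2)] by simp_all
    then have "smult a (vm_H t u) + smult b (vm_x t (vm_x t u)) - smult c (vm_y (vm_y u))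
        \<in> vm_part r q"
      using 8(2) by (intro vm_part_lin vm_part_cases)
    moreover have "vm_act t Z u
        = smult a (vm_H t u) + smult b (vm_x t (vm_x t u)) - smult c (vm_y (vm_y u))"
      using vm_act_expand[of t a b c 0 0 u] by (simp add: Z)
    ultimately show ?thesis by (simp only: True add_0)
  next
    case False
    then have p: "p = 1" using bit_cases by auto
    then obtain d e where Z: "Z = cmat_scale d osp_x + cmat_scale e osp_y"
      using 8 mem_osp_part_1_iff by auto
    have "smult d (vm_x t u) + smult e (vm_y u) \<in> vm_part r (q + 1)"
      using 8(2) by (intro vm_part_lin vm_part_cases)
    moreover have "vm_act t Z u = smult d (vm_x t u) + smult e (vm_y u)"
      using vm_act_expand[of t 0 0 0 d e u] by (simp add: Z)
    ultimately show ?thesis by (simp only: p add.commute[of 1])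
  qed
next
  case (9 A p B q u)
  then show ?case by (rule vm_superbracket)
qed


lemma vm_highest_weight: "highest_weight_vector smult (vm_part r) (vm_act t) t r 1"
proof -
  have "vm_H t 1 = smult t 1" "vm_x t 1 = 0"
    by (auto simp: poly_eq_iff one_pCons coeff_pCons split: nat.split)
  then show ?thesis
    by (auto simp: highest_weight_vector_def vm_act_gens vm_part_def)
qed

lemma vm_generated: "generated_by smult (vm_act t) 1"
  unfolding generated_by_def
proof (intro allI impI)
  fix S :: "complex poly set"
  assume S: "poly_vs.subspace S \<and> (\<forall>Z\<in>osp. \<forall>u\<in>S. vm_act t Z u \<in> S) \<and> 1 \<in> S"
  have y: "pCons 0 u \<in> S" if "u \<in> S" for u
    using S that osp_gens(5) vm_act_gens(5)[of t u] by (metis vm_y_def)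
  have "p \<in> S" for p
  proof (induction p)
    case 0
    then show ?case using S poly_vs.subspace_0 by blast
  next
    case (pCons a p)
    have "pCons a p = smult a 1 + pCons 0 p" by simp
    then show ?case using S y[OF pCons(2)] poly_vs.subspace_add poly_vs.subspace_scale by metis
  qed
  then show "S = UNIV" by auto
qed

text \<open>The homomorphism from the model to an arbitrary module.\<close>

definition vm_hom ::
  "(complex \<Rightarrow> 'w::ab_group_add \<Rightarrow> 'w) \<Rightarrow> (complex^3^3 \<Rightarrow> 'w \<Rightarrow> 'w) \<Rightarrow> 'w \<Rightarrow> complex poly \<Rightarrow> 'w" where
  "vm_hom smul \<delta> w p = fold_coeffs (\<lambda>a u. smul a w + \<delta> osp_y u) p 0"

lemma vm_hom_exists:
  fixes smul :: "complex \<Rightarrow> 'w::ab_group_add \<Rightarrow> 'w"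
  assumes "osp_module smul W \<delta>" and w: "highest_weight_vector smul W \<delta> t r w"
  shows "osp_hom smult (vm_part r) (vm_act t) smul W \<delta> (vm_hom smul \<delta> w)"
    and "vm_hom smul \<delta> w 1 = w"
proof -
  interpret W: osp_module smul W \<delta> by fact
  let ?f = "vm_hom smul \<delta> w"
  have wr: "w \<in> W r" and wH: "\<delta> osp_H w = smul t w" and wx: "\<delta> osp_x w = 0"
    using w by (auto simp: highest_weight_vector_def)
  have f0: "?f 0 = 0" by (simp add: vm_hom_def)
  have fC: "?f (pCons a p) = smul a w + \<delta> osp_y (?f p)" for a p
    by (cases "p = 0 \<and> a = 0") (auto simp: vm_hom_def W.act_zero)
  show "?f 1 = w" by (simp add: one_pCons fC f0 W.act_zero)
  have fadd: "?f (p + q) = ?f p + ?f q" for p q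
    by (induction p q rule: poly_induct2)
       (auto simp: f0 fC W.scale_left_distrib W.act_add algebra_simps)
  have fscale: "?f (smult c p) = smul c (?f p)" for c p
    by (induction p) (auto simp: f0 fC W.scale_right_distrib W.act_scale)
  have fminus: "?f (- p) = - ?f p" for p using fscale[of "-1" p] by simp
  have fdiff: "?f (p - q) = ?f p - ?f q" for p q
    using fadd[of p "- q"] by (simp add: fminus)
  have fy: "?f (vm_y p) = \<delta> osp_y (?f p)" for p by (simp add: vm_y_def fC)
  have split: "pCons a p = smult a 1 + vm_y p" for a p by (simp add: vm_y_def)
  have one: "vm_H t 1 = smult t 1" "vm_x t 1 = 0"
    by (auto simp: poly_eq_iff one_pCons coeff_pCons split: nat.split)
  have f1: "?f 1 = w" by fact
  have zero: "vm_H t 0 = 0" "vm_x t 0 = 0" by (auto simp: poly_eq_iff)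
  have fH: "?f (vm_H t p) = \<delta> osp_H (?f p)" for p
  proof (induction p)
    case 0
    then show ?case by (simp add: zero f0 W.act_zero)
  next
    case (pCons a p)
    then show ?case unfolding split
      by (simp only: vm_add vm_smult vm_rel one fadd fscale fdiff fy f1 W.act_add W.act_scale
          W.rel_Hy wH osp_gens W.scale_scale)
  qed
  have fx: "?f (vm_x t p) = \<delta> osp_x (?f p)" for p
  proof (induction p)
    case 0
    then show ?case by (simp add: zero f0 W.act_zero)
  next
    case (pCons a p)
    then show ?case unfolding split
      by (simp only: vm_add vm_smult vm_rel one fadd fscale fdiff fy fH f1 f0 smult_0_right W.act_add
          W.act_scale W.rel_xy wx osp_gens W.scale_zero_right)
  qed
  have grade: "\<forall>q. p \<in> vm_part r q \<longrightarrow> ?f p \<in> W q" for p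
  proof (induction p)
    case 0
    then show ?case using W.subspace_0[OF W.subspace_part] by (simp add: f0)
  next
    case (pCons a p)
    show ?case
    proof (intro allI impI)
      fix q
      assume q: "pCons a p \<in> vm_part r q"
      have "p \<in> vm_part r (1 + q)"
      proof -
        have "of_nat k + r = 1 + q" if "coeff p k \<noteq> 0" for k
        proof -
          have "of_nat (Suc k) + r = q" using q that
            by (auto simp: vm_part_def simp del: of_nat_Suc dest!: spec[of _ "Suc k"])
          then show ?thesis using bit_cases[of "of_nat k"] bit_cases[of r] bit_cases[of q] by auto
        qed
        then show ?thesis by (auto simp: vm_part_def)
      qed
      then have "?f p \<in> W (1 + q)" using pCons(2) by blast
      then have "\<delta> osp_y (?f p) \<in> W (1 + (1 + q))"
        by (rule W.action_graded[OF osp_part_gens(5)])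
      moreover have "1 + (1 + q) = q" using bit_cases[of q] by auto
      moreover have "smul a w \<in> W q"
      proof (cases "a = 0")
        case True
        then show ?thesis using W.subspace_0[OF W.subspace_part] by simp
      next
        case False
        then have "r = q" using q by (auto simp: vm_part_def dest!: spec[of _ 0])
        then show ?thesis using wr W.subspace_scale[OF W.subspace_part] by simp
      qed
      ultimately show "?f (pCons a p) \<in> W q"
        using W.subspace_add[OF W.subspace_part] by (simp add: fC)
    qed
  qed
  have "Vector_Spaces.linear smult smul ?f"
    by unfold_locales (simp_all add: fadd fscale)
  moreover have "?f (vm_act t Z u) = \<delta> Z (?f u)" if Zosp: "Z \<in> osp" for Z u
  proof -
    obtain a b c d e where Z: "Z = cmat_scale a osp_H + cmat_scale b osp_X + cmat_scale c osp_Y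
      + cmat_scale d osp_x + cmat_scale e osp_y"
      using Zosp unfolding mem_osp_iff by blast
    show ?thesis unfolding Z vm_act_expand W.action_expand
      by (simp add: fadd fscale fdiff fy fH fx W.rel_X W.rel_Y)
  qed
  ultimately show "osp_hom smult (vm_part r) (vm_act t) smul W \<delta> ?f"
    using grade by (auto simp: osp_hom_def)
qed

theorem super_verma_exists: "super_verma t smult (vm_part r) (vm_act t) 1"
  unfolding super_verma_def
proof (intro conjI exI[of _ r] allI impI)
  fix W :: "bit \<Rightarrow> complex poly set" and \<delta> w
  assume "osp_module smult W \<delta> \<and> highest_weight_vector smult W \<delta> t r w"
  then show "\<exists>f. osp_hom smult (vm_part r) (vm_act t) smult W \<delta> f \<and> f 1 = w"
    using vm_hom_exists[of smult W \<delta> t r w] by blast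
qed (simp_all add: vm_module vm_generated vm_highest_weight)

theorem super_verma_universal:
  fixes smul :: "complex \<Rightarrow> 'v::ab_group_add \<Rightarrow> 'v" and smul' :: "complex \<Rightarrow> 'w::ab_group_add \<Rightarrow> 'w"
  assumes "super_verma t smul V \<gamma> v" and r: "v \<in> V r"
    and "osp_module smul' W \<delta>" and w: "highest_weight_vector smul' W \<delta> t r w"
  shows "\<exists>!f. osp_hom smul V \<gamma> smul' W \<delta> f \<and> f v = w"
proof -
  interpret V: osp_module smul V \<gamma> using assms by (simp add: super_verma_def)
  interpret W: osp_module smul' W \<delta> by fact
  have "v \<noteq> 0" and gen: "generated_by smul \<gamma> v" using assms by (auto simp: super_verma_def)
  obtain r' where r': "v \<in> V r'" and univ: "\<And>(M :: bit \<Rightarrow> complex poly set) \<beta> m.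
      osp_module smult M \<beta> \<Longrightarrow> highest_weight_vector smult M \<beta> t r' m \<Longrightarrow>
      \<exists>f. osp_hom smul V \<gamma> smult M \<beta> f \<and> f v = m"
    using assms(1) by (auto simp: super_verma_def highest_weight_vector_def)
  have "r' = r"
    using r r' V.parts_disjoint \<open>v \<noteq> 0\<close> bit_cases[of r] bit_cases[of r'] by auto
  then obtain g where g: "osp_hom smul V \<gamma> smult (vm_part r) (vm_act t) g" "g v = 1"
    using univ[OF vm_module vm_highest_weight] by auto
  define h where "h = vm_hom smul' \<delta> w"
  have h: "osp_hom smult (vm_part r) (vm_act t) smul' W \<delta> h" "h 1 = w"
    using vm_hom_exists[OF assms(3) w] by (simp_all add: h_def)
  have "osp_hom smul V \<gamma> smul' W \<delta> (h \<circ> g)"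
    using g(1) h(1) unfolding osp_hom_def by (fastforce intro: Vector_Spaces.linear_compose)
  moreover have "f1 = f2" if f: "osp_hom smul V \<gamma> smul' W \<delta> f1" "osp_hom smul V \<gamma> smul' W \<delta> f2"
    and eq: "f1 v = f2 v" for f1 f2
  proof -
    have add: "f1 (a + b) = f1 a + f1 b" "f2 (a + b) = f2 a + f2 b"
      and sc: "f1 (smul c a) = smul' c (f1 a)" "f2 (smul c a) = smul' c (f2 a)" for a b c
      using f unfolding osp_hom_def Vector_Spaces.linear_def module_hom_def module_hom_axioms_def
      by simp_all
    have "f1 0 = f2 0" using add[of 0 0] by simp
    then have "V.subspace {u. f1 u = f2 u}"
      by (simp add: V.subspace_def add sc)
    moreover have "\<forall>Z\<in>osp. \<forall>u\<in>{u. f1 u = f2 u}. \<gamma> Z u \<in> {u. f1 u = f2 u}"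
      using f by (simp add: osp_hom_def)
    ultimately have "{u. f1 u = f2 u} = UNIV"
      using gen eq unfolding generated_by_def by blast
    then show ?thesis by auto
  qed
  ultimately show ?thesis using g(2) h(2) by (metis comp_apply)
qed

end

(*
  Symmetry of the two odd generators of the real form is equivalent to the single adjunction
  y* = -x, and this implies symmetry of the even part because H = xy + yx, X = x^2, Y = -y^2.
  If V_t is unitary, then <y v, y v> = -<v, x y v> = -cnj t <v, v>, which forces t to be real and
  negative. Conversely, for t < 0 all the coefficients c_k in x y^k v = c_k y^(k-1) v
  (k > 0) are negative, and the vectors y^k v become orthogonal with
  <y^k v, y^k v> = (-c_1) ... (-c_k). This form on the polynomial model is transported to an arbitrary
  super Verma module, which embeds into the model by universality.
*)
theory Submission
  imports Defs
begin

section \<open>Sesquilinear calculus and pullback of hermitian forms\<close>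

lemma positive_hermitianD:
  assumes "positive_hermitian smul h"
  shows "h (u + v) w = h u w + h v w"
    and "h (smul c u) v = c * h u v"
    and "h v u = cnj (h u v)"
    and "h u (v + w) = h u v + h u w"
    and "h u (smul c v) = cnj c * h u v"
    and "u \<noteq> 0 \<Longrightarrow> h u u \<in> \<real>"
    and "u \<noteq> 0 \<Longrightarrow> Re (h u u) > 0"
proof -
  have add: "h (u + v) w = h u w + h v w" and scale: "h (smul c u) v = c * h u v"
    and sym: "h v u = cnj (h u v)" for u v w c
    using assms unfolding positive_hermitian_def by blast+
  show "h (u + v) w = h u w + h v w" "h (smul c u) v = c * h u v" "h v u = cnj (h u v)"
    by (fact add scale sym)+
  show "h u (v + w) = h u v + h u w"
    by (metis add sym complex_cnj_add)
  show "h u (smul c v) = cnj c * h u v"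
    by (metis scale sym complex_cnj_mult)
  show "u \<noteq> 0 \<Longrightarrow> h u u \<in> \<real>" "u \<noteq> 0 \<Longrightarrow> Re (h u u) > 0"
    using assms unfolding positive_hermitian_def by blast+
qed

text \<open>Injectivity keeps the form definite. This carries the form on the polynomial model over
  to an abstract module.\<close>

lemma positive_hermitian_pullback:
  assumes h: "positive_hermitian smul' h"
    and "Vector_Spaces.linear smul smul' f" "inj f"
  shows "positive_hermitian smul (\<lambda>u w. h (f u) (f w))"
proof -
  interpret f: Vector_Spaces.linear smul smul' f by fact
  show ?thesis unfolding positive_hermitian_def f.add f.scale
  proof (intro conjI allI impI)
    show "h (f v) (f u) = cnj (h (f u) (f v))" for u v
      by (rule positive_hermitianD(3)[OF h])
    fix u :: 'b
    assume "u \<noteq> 0"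
    then have "f u \<noteq> 0" using \<open>inj f\<close> by (metis f.zero injD)
    then show "h (f u) (f u) \<in> \<real>" "0 < Re (h (f u) (f u))"
      by (fact positive_hermitianD(6,7)[OF h])+
  qed (fact positive_hermitianD(1,2)[OF h])+
qed

text \<open>The numbers e^(i pi/4) and e^(-i pi/4) differ by the factor e^(i pi/2) = i. So the
  scalar in the odd symmetry condition, once moved to the second argument of a form, reappears times
  i.\<close>

lemma cnj_exp_neg_quarter_pi:
  "cnj (exp (- \<i> * of_real pi / 4)) = \<i> * exp (- \<i> * of_real pi / 4)"
proof -
  have "cnj (exp (- \<i> * of_real pi / 4)) = exp (\<i> * of_real (pi / 2) + - \<i> * of_real pi / 4)"
    by (simp add: exp_cnj field_simps)
  also have "\<dots> = \<i> * exp (- \<i> * of_real pi / 4)"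
    unfolding exp_add by (metis cis_conv_exp cis_pi_half)
  finally show ?thesis .
qed

section \<open>Complex coordinates on the real form\<close>

lemma scaleR_eq_cmat_scale: "a *\<^sub>R A = cmat_scale (of_real a) A"
  unfolding cmat_scale_def vec_eq_iff vector_scaleR_component by (simp add: scaleR_conv_of_real)

text \<open>What matters later is that the coefficient of H is imaginary and those of X and Y are
  conjugate. The zero odd terms give \<open>Z\<close> the shape that \<open>action_expand\<close>
  rewrites.\<close>

lemma osp_real_part_0E:
  assumes "Z \<in> osp_real_part 0"
  obtains a b c :: real where "Z = cmat_scale (\<i> * a) osp_H + cmat_scale (b + \<i> * c) osp_X
    + cmat_scale (b - \<i> * c) osp_Y + cmat_scale 0 osp_x + cmat_scale 0 osp_y"
proof -
  have "Z \<in> span {cmat_scale \<i> osp_H, osp_X + osp_Y, cmat_scale \<i> (osp_X - osp_Y)}"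
    using assms by (simp add: osp_real_part_def)
  then obtain a b c where "Z - a *\<^sub>R cmat_scale \<i> osp_H - b *\<^sub>R (osp_X + osp_Y)
      - c *\<^sub>R cmat_scale \<i> (osp_X - osp_Y) = 0"
    unfolding span_insert span_empty by auto
  then have "Z = cmat_scale (\<i> * a) osp_H + cmat_scale (b + \<i> * c) osp_X
    + cmat_scale (b - \<i> * c) osp_Y + cmat_scale 0 osp_x + cmat_scale 0 osp_y"
    unfolding scaleR_eq_cmat_scale
    by (simp add: algebra_simps cmat_scale_def vec_eq_iff)
  then show thesis by (rule that)
qed

text \<open>The coefficient of x is -i times the conjugate of the coefficient of y.\<close>

lemma osp_real_part_1E:
  assumes "Z \<in> osp_real_part 1"
  obtains a b :: real where "Z = cmat_scale 0 osp_H + cmat_scale 0 osp_X + cmat_scale 0 osp_Y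
    + cmat_scale (- \<i> * a - b) osp_x + cmat_scale (a + \<i> * b) osp_y"
proof -
  have "Z \<in> span {cmat_scale (- \<i>) osp_x + osp_y, - osp_x + cmat_scale \<i> osp_y}"
    using assms by (simp add: osp_real_part_def)
  then obtain a b where "Z - a *\<^sub>R (cmat_scale (- \<i>) osp_x + osp_y)
      - b *\<^sub>R (- osp_x + cmat_scale \<i> osp_y) = 0"
    unfolding span_insert span_empty by auto
  then have "Z = cmat_scale 0 osp_H + cmat_scale 0 osp_X + cmat_scale 0 osp_Y
    + cmat_scale (- \<i> * a - b) osp_x + cmat_scale (a + \<i> * b) osp_y"
    unfolding scaleR_eq_cmat_scale
    by (simp add: algebra_simps cmat_scale_def vec_eq_iff)
  then show thesis by (rule that)
qed

lemma osp_real_part_1_gens: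
  "cmat_scale (- \<i>) osp_x + osp_y \<in> osp_real_part 1"
  "- osp_x + cmat_scale \<i> osp_y \<in> osp_real_part 1"
  unfolding osp_real_part_def by (auto intro: span_base)

section \<open>Unitarity as an adjunction between x and y\<close>

context osp_module
begin

text \<open>Symmetry for the two odd basis vectors gives two linear equations between the four
  numbers <xu,w>, <yu,w>, <u,xw> and <u,yw>; the common scalar \<open>e\<close> cancels because
  \<open>cnj e\<close> is a multiple of \<open>e\<close>.\<close>

lemma adjoint_if_symmetric:
  assumes h: "positive_hermitian smul h"
    and sym: "\<forall>Z\<in>osp_real_part 1.
      symmetric_wrt h (\<lambda>u. smul (exp (- \<i> * of_real pi / 4)) (\<gamma> Z u))"
  shows "h (\<gamma> osp_y u) w = - h u (\<gamma> osp_x w)"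
proof -
  define e where "e = exp (- \<i> * of_real pi / 4)"
  have cnj_e: "cnj e = \<i> * e" unfolding e_def by (rule cnj_exp_neg_quarter_pi)
  have e: "e \<noteq> 0" by (simp add: e_def)
  note form = positive_hermitianD(1,2,4,5)[OF h]
  let ?A = "cmat_scale (- \<i>) osp_x + osp_y" and ?B = "- osp_x + cmat_scale \<i> osp_y"
  have "?A \<in> osp_real_part 1" "?B \<in> osp_real_part 1"
    by (fact osp_real_part_1_gens)+
  then have "h (smul e (\<gamma> ?A u)) w = h u (smul e (\<gamma> ?A w))"
    and "h (smul e (\<gamma> ?B u)) w = h u (smul e (\<gamma> ?B w))"
    using sym unfolding symmetric_wrt_def e_def by blast+
  moreover have "\<gamma> ?A z = smul (- \<i>) (\<gamma> osp_x z) + \<gamma> osp_y z" for z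
    by (simp only: action_add action_scale osp_gens osp_scale)
  moreover have "\<gamma> ?B z = smul (- 1) (\<gamma> osp_x z) + smul \<i> (\<gamma> osp_y z)" for z
  proof -
    have "?B = cmat_scale (- 1) osp_x + cmat_scale \<i> osp_y" by simp
    then show ?thesis by (simp only: action_add action_scale osp_gens osp_scale)
  qed
  ultimately have
    "e * (- \<i> * h (\<gamma> osp_x u) w + h (\<gamma> osp_y u) w)
      = e * (- h u (\<gamma> osp_x w) + \<i> * h u (\<gamma> osp_y w))"
    "e * (- h (\<gamma> osp_x u) w + \<i> * h (\<gamma> osp_y u) w)
      = e * (- \<i> * h u (\<gamma> osp_x w) + h u (\<gamma> osp_y w))"
    by (simp_all only: form cnj_e complex_cnj_minus complex_cnj_i complex_cnj_one)
      (simp_all add: algebra_simps)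
  then have "- \<i> * h (\<gamma> osp_x u) w + h (\<gamma> osp_y u) w = - h u (\<gamma> osp_x w) + \<i> * h u (\<gamma> osp_y w)"
    "- h (\<gamma> osp_x u) w + \<i> * h (\<gamma> osp_y u) w = - \<i> * h u (\<gamma> osp_x w) + h u (\<gamma> osp_y w)"
    using e by (metis mult_left_cancel)+
  \<comment> \<open>The first equation minus i times the second eliminates both <xu,w> and
    <u,yw>.\<close>
  then show ?thesis by (simp add: complex_eq_iff)
qed

text \<open>Hermitian symmetry turns y* = -x into x* = -y; the quadratic relations then give H* = H
  and X* = -Y.\<close>

lemma unitary_if_adjoint:
  assumes h: "positive_hermitian smul h"
    and orth: "\<forall>u\<in>V 0. \<forall>w\<in>V 1. h u w = 0"
    and y: "\<And>u w. h (\<gamma> osp_y u) w = - h u (\<gamma> osp_x w)"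
  shows "unitary smul V \<gamma>"
proof -
  note form = positive_hermitianD(1,2,4,5)[OF h]
  have minus: "h (- u) w = - h u w" "h u (- w) = - h u w" for u w
    using form(2)[of "- 1" u w] form(4)[of u "- 1" w] by simp_all
  have x: "h (\<gamma> osp_x u) w = - h u (\<gamma> osp_y w)" for u w
    by (metis y positive_hermitianD(3)[OF h] complex_cnj_minus minus_minus)
  have "\<gamma> osp_H u = \<gamma> osp_x (\<gamma> osp_y u) + \<gamma> osp_y (\<gamma> osp_x u)" for u
    by (simp add: rel_xy)
  then have H: "h (\<gamma> osp_H u) w = h u (\<gamma> osp_H w)" for u w
    by (simp add: form x y)
  have X: "h (\<gamma> osp_X u) w = - h u (\<gamma> osp_Y w)" and Y: "h (\<gamma> osp_Y u) w = - h u (\<gamma> osp_X w)"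
    for u w
    by (simp_all add: rel_X rel_Y minus x y)
  have "symmetric_wrt h (\<lambda>u. smul \<i> (\<gamma> Z u))" if Z: "Z \<in> osp_real_part 0" for Z
  proof (rule osp_real_part_0E[OF Z])
    fix a b c :: real
    assume Z: "Z = cmat_scale (\<i> * a) osp_H + cmat_scale (b + \<i> * c) osp_X
      + cmat_scale (b - \<i> * c) osp_Y + cmat_scale 0 osp_x + cmat_scale 0 osp_y"
    \<comment> \<open>The conjugate coefficients of X and Y are swapped by the adjunction, so
      \<open>Z\<close> is skew-adjoint and i times it is symmetric.\<close>
    show ?thesis unfolding symmetric_wrt_def Z action_expand
      by (simp only: form H X Y) (simp add: algebra_simps)
  qed
  moreover have "symmetric_wrt h (\<lambda>u. smul (exp (- \<i> * of_real pi / 4)) (\<gamma> Z u))"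
    if Z: "Z \<in> osp_real_part 1" for Z
  proof -
    define e where "e = exp (- \<i> * of_real pi / 4)"
    have cnj_e: "cnj e = \<i> * e" unfolding e_def by (rule cnj_exp_neg_quarter_pi)
    show ?thesis
    proof (rule osp_real_part_1E[OF Z])
      fix a b :: real
      assume Z: "Z = cmat_scale 0 osp_H + cmat_scale 0 osp_X + cmat_scale 0 osp_Y
        + cmat_scale (- \<i> * a - b) osp_x + cmat_scale (a + \<i> * b) osp_y"
      \<comment> \<open>The factor i in \<open>cnj_e\<close> compensates the factor -i between the
        coefficient of x and the conjugate coefficient of y.\<close>
      show ?thesis unfolding symmetric_wrt_def e_def[symmetric] Z action_expand
        by (simp only: form x y cnj_e) (simp add: algebra_simps)
    qed
  qed
  ultimately show ?thesis
    unfolding unitary_def using h orth by blast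
qed

end

section \<open>The invariant form on the polynomial model\<close>

definition vm_norm :: "complex \<Rightarrow> nat \<Rightarrow> real" where
  "vm_norm t k = (\<Prod>j<k. - Re (vm_coef t (Suc j)))"

definition vm_form :: "complex \<Rightarrow> complex poly \<Rightarrow> complex poly \<Rightarrow> complex" where
  "vm_form t p q = (\<Sum>k\<le>degree p. vm_norm t k * coeff p k * cnj (coeff q k))"

text \<open>The bound \<open>degree p\<close> treats the two arguments unequally; with a common
  bound, additivity and hermitian symmetry hold term by term.\<close>

lemma vm_form_eq:
  assumes "degree p \<le> n"
  shows "vm_form t p q = (\<Sum>k\<le>n. vm_norm t k * coeff p k * cnj (coeff q k))"
  unfolding vm_form_def using assms
  by (intro sum.mono_neutral_left) (auto simp: coeff_eq_0)

text \<open>The coefficient at index \<open>Suc j\<close> is t - j/2 for even j and -(j + 1)/2 for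
  odd j, so each factor of the product is positive.\<close>

lemma vm_norm_pos:
  assumes "Re t < 0"
  shows "vm_norm t k > 0"
  unfolding vm_norm_def
proof (rule prod_pos)
  fix j
  have "real j / 2 \<ge> 0" by simp
  then show "0 < - Re (vm_coef t (Suc j))"
    unfolding vm_coef_def using assms by simp
qed

lemma positive_hermitian_vm_form:
  assumes "Re t < 0"
  shows "positive_hermitian smult (vm_form t)"
  unfolding positive_hermitian_def
proof (intro conjI allI impI)
  fix u v w :: "complex poly" and c
  let ?n = "max (degree u) (degree v)"
  have "vm_form t (u + v) w = (\<Sum>k\<le>?n. vm_norm t k * coeff (u + v) k * cnj (coeff w k))"
    by (rule vm_form_eq) (rule degree_add_le_max)
  also have "\<dots> = vm_form t u w + vm_form t v w"
    by (simp add: vm_form_eq[of _ ?n] algebra_simps sum.distrib)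
  finally show "vm_form t (u + v) w = vm_form t u w + vm_form t v w" .
  \<comment> \<open>Both sides are summed up to \<open>degree u\<close>, since scaling by c = 0
    lowers the degree.\<close>
  show "vm_form t (smult c u) v = c * vm_form t u v"
    by (subst (1 2) vm_form_eq[of _ "degree u"])
      (simp_all add: degree_smult_le sum_distrib_left mult_ac)
  show "vm_form t v u = cnj (vm_form t u v)"
    by (simp add: vm_form_eq[of _ ?n] mult_ac)
next
  fix u :: "complex poly"
  assume "u \<noteq> 0"
  have eq: "vm_form t u u = of_real (\<Sum>k\<le>degree u. vm_norm t k * (cmod (coeff u k))\<^sup>2)"
    unfolding vm_form_def of_real_sum of_real_mult complex_norm_square by (simp add: mult.assoc)
  have "0 < (\<Sum>k\<le>degree u. vm_norm t k * (cmod (coeff u k))\<^sup>2)"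
  proof (rule sum_pos2)
    \<comment> \<open>The leading coefficient supplies the strictly positive term.\<close>
    show "0 < vm_norm t (degree u) * (cmod (coeff u (degree u)))\<^sup>2"
      using \<open>u \<noteq> 0\<close> vm_norm_pos[OF assms] by simp
    show "0 \<le> vm_norm t k * (cmod (coeff u k))\<^sup>2" for k
      using vm_norm_pos[OF assms, of k] by simp
  qed auto
  then show "vm_form t u u \<in> \<real>" "0 < Re (vm_form t u u)"
    unfolding eq by simp_all
qed

text \<open>The only pairings to compare are those of y^k with y^(k+1): one side gives
  \<open>vm_norm t (Suc k)\<close>, the other -c_(k+1) times \<open>vm_norm t k\<close>, which agree
  by the product formula. Real t makes every c_k real, so \<open>Re\<close> and \<open>cnj\<close>
  disappear.\<close>

lemma vm_form_y:
  assumes "t \<in> \<real>"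
  shows "vm_form t (vm_y p) q = - vm_form t p (vm_x t q)"
proof -
  have "vm_coef t k \<in> \<real>" for k
    using assms unfolding vm_coef_def by auto
  then have coef: "of_real (Re (vm_coef t k)) = vm_coef t k" "cnj (vm_coef t k) = vm_coef t k" for k
    by (simp_all add: Reals_cnj_iff)
  have "vm_form t (vm_y p) q
      = (\<Sum>k\<le>Suc (degree p). vm_norm t k * coeff (vm_y p) k * cnj (coeff q k))"
    by (rule vm_form_eq) (simp add: vm_y_def degree_pCons_le)
  \<comment> \<open>The constant term of \<open>vm_y p\<close> vanishes; the shifted sum then
    matches termwise.\<close>
  also have "\<dots> = - vm_form t p (vm_x t q)"
    unfolding sum.atMost_Suc_shift vm_form_def
    by (simp add: vm_y_def vm_norm_def coef sum_negf[symmetric] mult_ac)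
  finally show ?thesis .
qed

lemma vm_form_orthogonal:
  assumes "p \<in> vm_part r 0" "q \<in> vm_part r 1"
  shows "vm_form t p q = 0"
  unfolding vm_form_def
proof (rule sum.neutral, rule ballI)
  fix k
  \<comment> \<open>Otherwise \<open>of_nat k + r\<close> would be both 0 and 1.\<close>
  have "coeff p k = 0 \<or> coeff q k = 0"
    using assms unfolding vm_part_def by force
  then show "vm_norm t k * coeff p k * cnj (coeff q k) = 0" by auto
qed

section \<open>Embedding into the model and the unitarity criterion\<close>

lemma super_verma_embeds:
  assumes "super_verma t smul V \<gamma> v"
  obtains r g where "osp_hom smul V \<gamma> smult (vm_part r) (vm_act t) g" "inj g"
proof -
  have mod: "osp_module smul V \<gamma>" using assms by (simp add: super_verma_def)
  \<comment> \<open>The parity of \<open>v\<close> selects the grading of the model, in which 1 has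
    parity \<open>r\<close>.\<close>
  obtain r where hw: "highest_weight_vector smul V \<gamma> t r v"
    using assms by (auto simp: super_verma_def)
  then have r: "v \<in> V r" by (simp add: highest_weight_vector_def)
  obtain g where g: "osp_hom smul V \<gamma> smult (vm_part r) (vm_act t) g" "g v = 1"
    using super_verma_universal[OF assms r vm_module vm_highest_weight] by blast
  obtain f where f: "osp_hom smult (vm_part r) (vm_act t) smul V \<gamma> f" "f 1 = v"
    using vm_hom_exists[OF mod hw] by blast
  interpret V: osp_module smul V \<gamma> by fact
  have "osp_hom smul V \<gamma> smul V \<gamma> (f \<circ> g)"
    using g(1) f(1) unfolding osp_hom_def by (fastforce intro: Vector_Spaces.linear_compose)
  moreover have "osp_hom smul V \<gamma> smul V \<gamma> id"
    unfolding osp_hom_def by (simp add: V.linear_id)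
  \<comment> \<open>Both are endomorphisms of the module fixing \<open>v\<close>, so they coincide
    by uniqueness in the universal property; the left inverse \<open>f\<close> makes
    \<open>g\<close> injective.\<close>
  ultimately have "f \<circ> g = id"
    using super_verma_universal[OF assms r mod hw] g(2) f(2) by (metis comp_apply id_apply)
  then have "inj g" by (metis inj_on_id inj_on_imageI2)
  with g(1) show thesis by (rule that)
qed

theorem theorem4p5:
  fixes t :: complex
    and smul :: "complex \<Rightarrow> 'v::ab_group_add \<Rightarrow> 'v"
    and V :: "bit \<Rightarrow> 'v set"
    and \<gamma> :: "complex^3^3 \<Rightarrow> 'v \<Rightarrow> 'v"
    and v :: 'v
  assumes "t \<notin> \<nat>"
    and "super_verma t smul V \<gamma> v"
  shows "unitary smul V \<gamma> \<longleftrightarrow> t \<in> \<real> \<and> Re t < 0"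
proof -
  interpret osp_module smul V \<gamma> using assms(2) by (simp add: super_verma_def)
  show ?thesis
  proof
    assume "unitary smul V \<gamma>"
    then obtain h where h: "positive_hermitian smul h"
      and y: "\<And>u w. h (\<gamma> osp_y u) w = - h u (\<gamma> osp_x w)"
      unfolding unitary_def using adjoint_if_symmetric by blast
    have v: "v \<noteq> 0" "\<gamma> osp_H v = smul t v" "\<gamma> osp_x v = 0"
      using assms(2) by (auto simp: super_verma_def highest_weight_vector_def)
    then have xy: "\<gamma> osp_x (\<gamma> osp_y v) = smul t v"
      by (simp add: rel_xy act_zero)
    \<comment> \<open>With t nonzero, x y v = t v forces y v to be nonzero, so its squared length
      \<open>a\<close> is strictly positive.\<close>
    have "t \<noteq> 0" using assms(1) by auto
    then have "\<gamma> osp_y v \<noteq> 0"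
      using xy v(1) by (metis act_zero osp_gens(4) scale_eq_0_iff)
    then obtain a where a: "h (\<gamma> osp_y v) (\<gamma> osp_y v) = of_real a" "a > 0"
      using positive_hermitianD(6,7)[OF h] by (metis Reals_cases Re_complex_of_real)
    obtain b where b: "h v v = of_real b" "b > 0"
      using positive_hermitianD(6,7)[OF h v(1)] by (metis Reals_cases Re_complex_of_real)
    have "of_real a = - cnj t * of_real b"
      using y[of v "\<gamma> osp_y v"] by (simp add: xy positive_hermitianD(5)[OF h] a b)
    then have "cnj t = of_real (- a / b)" using b(2) by (simp add: field_simps)
    then have "t = of_real (- a / b)" by (metis complex_cnj_cnj complex_cnj_complex_of_real)
    then show "t \<in> \<real> \<and> Re t < 0"
      using a(2) b(2) by (metis Re_complex_of_real Reals_of_real divide_neg_pos neg_less_0_iff_less)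
  next
    assume t: "t \<in> \<real> \<and> Re t < 0"
    obtain r g where g: "osp_hom smul V \<gamma> smult (vm_part r) (vm_act t) g" and "inj g"
      using super_verma_embeds[OF assms(2)] .
    have "positive_hermitian smul (\<lambda>u w. vm_form t (g u) (g w))"
      using t g \<open>inj g\<close> unfolding osp_hom_def
      by (intro positive_hermitian_pullback[OF positive_hermitian_vm_form]) blast+
    moreover have "\<forall>u\<in>V 0. \<forall>w\<in>V 1. vm_form t (g u) (g w) = 0"
    proof (intro ballI)
      fix u w
      assume "u \<in> V 0" "w \<in> V 1"
      then have "g u \<in> vm_part r 0" "g w \<in> vm_part r 1"
        using g unfolding osp_hom_def by blast+
      then show "vm_form t (g u) (g w) = 0" by (rule vm_form_orthogonal)
    qed
    \<comment> \<open>Since \<open>g\<close> intertwines the actions of x and y, the adjunction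
      pulls back from the model.\<close>
    moreover have "vm_form t (g (\<gamma> osp_y u)) (g w) = - vm_form t (g u) (g (\<gamma> osp_x w))" for u w
      using g t by (simp add: osp_hom_def vm_act_gens vm_form_y)
    ultimately show "unitary smul V \<gamma>" by (rule unitary_if_adjoint)
  qed
qed

end
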